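(* Let $\Gamma$ be a discrete subgroup of orientation-preserving isometries acting freely on $\mathbb{R}^{n+1}$ and let $(M:=\Gamma\setminus\mathbb{R}^{n+1},g,\mathcal{F})$ be a flat spin manifold with a minimal Riemannian flow $\mathcal{F}$ given by a unit vector field $\xi$. Assume that $M$ carries a non-zero $(\alpha,\beta)$-transversal Killing spinor $\psi$ for complex numbers $\alpha$ and $\beta$. Let $\varepsilon:\Gamma\to\mathrm{Spin}_{n+1}$ be the lift of $\Gamma$ giving the spin structure on $M$ and let $\overline{\xi}$ be the lift of $\xi$ to $\mathbb{R}^{n+1}$. Then $h=0$, $\beta=0$, and $\psi$ comes from a smooth spinor field $\overline{\psi}$ on $\mathbb{R}^{n+1}$ satisfying the following equivariance condition: (a) Case $\alpha=0$: the section $\overline{\psi}$ is constant on $\mathbb{R}^{n+1}$ and $\overline{\psi}=\varepsilon(\gamma)\overline{\psi}$ for every $\gamma\in\Gamma$. (b) Case $\alpha\neq0$: there exist two constant sections $\overline{\psi}_+$ and $\overline{\psi}_-$ on $\mathbb{R}^{n+1}$ (with $i\overline{\xi}\cdot\overline{\psi}_\pm=\pm\overline{\psi}_\pm$) such that $\overline{\psi}_x=e^{-i\alpha\langle x,\overline{\xi}\rangle}\overline{\psi}_++e^{i\alpha\langle x,\overline{\xi}\rangle}\overline{\psi}_-$ for all $x\in\mathbb{R}^{n+1}$, and $\overline{\psi}_\pm=e^{\pm i\alpha\langle t(\gamma),\overline{\xi}\rangle}\varepsilon(\gamma)\overline{\psi}_\pm$ for every $\gamma\in\Gamma$.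
   Context: A Riemannian flow $(M^{n+1},g,\mathcal{F})$ is given by a smooth unit vector field $\xi$ with $(\mathcal{L}_\xi g)(Z,W)=0$ for all $Z,W\perp\xi$. Put $Q=\xi^\perp$, $h(Z)=\nabla^M_Z\xi$ for $Z\in Q$, $\kappa=\nabla^M_\xi\xi$; the flow is minimal if $\kappa=0$ (equivalently $\xi$ is a Killing field). $\Omega(Z,W)=g(h(Z),W)$ on $Q$, extended by $\Omega(\xi,\cdot)=0$. On the spinor bundle $\Sigma M$ of a spin flow, with Clifford multiplication "$\cdot$" ($X\cdot X=-|X|^2$), the transversal connection is $\nabla_\xi\varphi=\nabla^M_\xi\varphi-\frac12\Omega\cdot\varphi-\frac12\xi\cdot\kappa\cdot\varphi$, $\nabla_Z\varphi=\nabla^M_Z\varphi-\frac12\xi\cdot h(Z)\cdot\varphi$ for $Z\in\Gamma(Q)$. An $(\alpha,\beta)$-transversal Killing spinor is a smooth section $\psi$ of $\Sigma M$ with $\nabla_\xi\psi=\alpha\,\xi\cdot\psi$ and $\nabla_Z\psi=\beta\,\xi\cdot Z\cdot\psi$ for all $Z\in\Gamma(Q)$. Write $t:\Gamma\to\mathbb{R}^{n+1}$ and $r:\Gamma\to\mathrm{SO}_{n+1}$ for the two components of $\Gamma\subset\mathrm{Isom}_+(\mathbb{R}^{n+1})=\mathbb{R}^{n+1}\rtimes\mathrm{SO}_{n+1}$, i.e. $\gamma(x)=r(\gamma)(x)+t(\gamma)$. A spin structure on $M=\Gamma\setminus\mathbb{R}^{n+1}$ is given by a group homomorphism $\varepsilon:\Gamma\to\mathrm{Spin}_{n+1}$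 with $\mathrm{Ad}\circ\varepsilon=r$, where $\mathrm{Ad}:\mathrm{Spin}_{n+1}\to\mathrm{SO}_{n+1}$ is the standard double covering. Spinor fields on $M$ correspond to smooth maps $\overline{\psi}:\mathbb{R}^{n+1}\to\mathbb{C}^{2^{[(n+1)/2]}}$ with $\overline{\psi}_x=\varepsilon(\gamma)\overline{\psi}_{\gamma^{-1}(x)}$ for all $x\in\mathbb{R}^{n+1}$, $\gamma\in\Gamma$. $\langle\cdot,\cdot\rangle$ is the Euclidean inner product, and subscripts $\pm$ denote the $\pm1$-eigenspaces of $i\overline{\xi}\cdot$.
   Formalization: The formal theorem assumes n ≥ 1, and α ≠ 0 when n = 1; otherwise β = 0 can fail: for n = 0, β is arbitrary, and for n = 1, α = 0, ξ = e₁ on the plane, ψ = exp(βy e₁·e₂)ψ₀ is a counterexample. *)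

theory Defs
  imports "HOL-Analysis.Analysis" "HOL-Algebra.Group"
begin

section \<open>Clifford algebra, spin group and spinor representation\<close>

text \<open>
  The real Clifford algebra of Euclidean space \<^typ>\<open>real ^ 'n\<close> with the convention
  \<open>v \<cdot> v = - |v|^2\<close>.  The component of \<^typ>\<open>real ^ ('n set)\<close> at \<open>A = {a1 < ... < ak}\<close> is the
  coefficient of the basis monomial \<open>e_A = e_a1 \<cdot> ... \<cdot> e_ak\<close>.  In \<open>e_A \<cdot> e_B\<close> every pair
  \<open>(a, b)\<close> with \<open>b < a\<close> contributes a sign from \<open>e_a \<cdot> e_b = - e_b \<cdot> e_a\<close>, and every common index
  contributes a sign from \<open>e_a \<cdot> e_a = -1\<close>.
\<close>

type_synonym 'n clifford = "(real, 'n set) vec"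

definition clifford_sign :: "'n::{finite,linorder} set \<Rightarrow> 'n set \<Rightarrow> real" where
  "clifford_sign A B = (\<Prod>a\<in>A. \<Prod>b\<in>B. if b \<le> a then - 1 else 1)"

definition clifford_mult ::
  "'n::{finite,linorder} clifford \<Rightarrow> 'n clifford \<Rightarrow> 'n clifford" (infixl \<open>\<odot>\<close> 70) where
  "x \<odot> y = (\<Sum>A\<in>UNIV. \<Sum>B\<in>UNIV. (clifford_sign A B * x $ A * y $ B) *\<^sub>R axis (sym_diff A B) 1)"

definition clifford_one :: "'n::{finite,linorder} clifford" where
  "clifford_one = axis {} 1"

definition clifford_vec :: "(real, 'n::{finite,linorder}) vec \<Rightarrow> 'n clifford" where
  "clifford_vec v = (\<Sum>i\<in>UNIV. v $ i *\<^sub>R axis {i} 1)"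

definition clifford_prod :: "(real, 'n::{finite,linorder}) vec list \<Rightarrow> 'n clifford" where
  "clifford_prod vs = foldr (\<lambda>v x. clifford_vec v \<odot> x) vs clifford_one"

definition Spin :: "('n::{finite,linorder}) clifford monoid" where
  "Spin = \<lparr> carrier = {clifford_prod vs | vs. even (length vs) \<and> (\<forall>v\<in>set vs. norm v = 1)},
            mult = (\<odot>), one = clifford_one \<rparr>"

text \<open>The double covering, \<open>Ad(u) v = u \<cdot> v \<cdot> u^(-1)\<close>; the lemma \<open>spin_Ad\<close> below shows that
  the description denotes.\<close>

definition spin_Ad :: "'n::{finite,linorder} clifford \<Rightarrow> ((real, 'n) vec, 'n) vec" where
  "spin_Ad u = matrix (\<lambda>v. THE w. clifford_vec w = u \<odot> clifford_vec v \<odot> m_inv Spin u)"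

text \<open>
  A complex spinor representation: a unital representation of the Clifford algebra of \<open>R^m\<close> on
  \<open>C^N\<close> with \<open>N = 2^[m/2]\<close>.  For dimensional reasons it is irreducible, hence unique up to
  isomorphism for \<open>m\<close> even, and one of the two irreducible ones (which restrict to the same
  representation of the spin group) for \<open>m\<close> odd.
\<close>

definition spinor_rep :: "('n::{finite,linorder} clifford \<Rightarrow> complex ^ 's ^ 's) \<Rightarrow> bool" where
  "spinor_rep \<rho> \<longleftrightarrow> CARD('s) = 2 ^ (CARD('n) div 2) \<and> linear \<rho> \<and> \<rho> clifford_one = mat 1 \<and>
     (\<forall>x y. \<rho> (x \<odot> y) = \<rho> x ** \<rho> y)"

lemma clifford_sign_sym_diff_left:
  "clifford_sign (sym_diff A B) C = clifford_sign A C * clifford_sign B C"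
proof -
  define f where "f a = (\<Prod>b\<in>C. if b \<le> a then - 1 else (1::real))" for a
  have sq: "f a * f a = 1" for a
    unfolding f_def prod.distrib[symmetric] by (rule prod.neutral) auto
  have fin: "finite X" for X :: "'a set" by simp
  have A: "prod f A = prod f (A - B) * prod f (A \<inter> B)"
    by (subst prod.union_disjoint[symmetric]) (auto simp: Un_Diff_Int intro!: prod.cong)
  have B: "prod f B = prod f (B - A) * prod f (A \<inter> B)"
    by (subst prod.union_disjoint[symmetric]) (auto intro!: prod.cong)
  have I: "prod f (A \<inter> B) * prod f (A \<inter> B) = 1"
    unfolding prod.distrib[symmetric] by (rule prod.neutral) (auto simp: sq)
  have "prod f (sym_diff A B) = prod f (A - B) * prod f (B - A)"
    by (rule prod.union_disjoint) auto
  also have "\<dots> = prod f A * prod f B"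
    unfolding A B using I by (simp add: mult_ac)
  finally show ?thesis unfolding clifford_sign_def f_def .
qed

lemma clifford_sign_sym_diff_right:
  "clifford_sign C (sym_diff A B) = clifford_sign C A * clifford_sign C B"
proof -
  define f where "f b = (\<Prod>a\<in>C. if b \<le> a then - 1 else (1::real))" for b
  have eq: "clifford_sign C X = prod f X" for X
    unfolding clifford_sign_def f_def by (rule prod.swap)
  have sq: "f a * f a = 1" for a
    unfolding f_def prod.distrib[symmetric] by (rule prod.neutral) auto
  have A: "prod f A = prod f (A - B) * prod f (A \<inter> B)"
    by (subst prod.union_disjoint[symmetric]) (auto simp: Un_Diff_Int intro!: prod.cong)
  have B: "prod f B = prod f (B - A) * prod f (A \<inter> B)"
    by (subst prod.union_disjoint[symmetric]) (auto intro!: prod.cong)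
  have I: "prod f (A \<inter> B) * prod f (A \<inter> B) = 1"
    unfolding prod.distrib[symmetric] by (rule prod.neutral) (auto simp: sq)
  have "prod f (sym_diff A B) = prod f (A - B) * prod f (B - A)"
    by (rule prod.union_disjoint) auto
  also have "\<dots> = prod f A * prod f B"
    unfolding A B using I by (simp add: mult_ac)
  finally show ?thesis unfolding eq .
qed

lemma linear_clifford_mult_left: "linear (\<lambda>x. x \<odot> y)"
  by (rule linearI)
     (simp_all add: clifford_mult_def algebra_simps sum.distrib scaleR_sum_right)

lemma linear_clifford_mult_right: "linear (\<lambda>y. x \<odot> y)"
  by (rule linearI)
     (simp_all add: clifford_mult_def algebra_simps sum.distrib scaleR_sum_right)

lemma clifford_mult_axis:
  "axis A 1 \<odot> axis B 1 = clifford_sign A B *\<^sub>R axis (sym_diff A B) 1"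
proof -
  have "axis A 1 \<odot> axis B 1 =
    (\<Sum>A'\<in>UNIV. \<Sum>B'\<in>UNIV. if B' = B then (if A' = A then
        clifford_sign A B *\<^sub>R axis (sym_diff A B) 1 else 0) else 0)"
    unfolding clifford_mult_def by (intro sum.cong refl) (auto simp: axis_def)
  then show ?thesis by simp
qed

lemma clifford_basis_expansion: "(x :: real ^ ('n::finite set)) = (\<Sum>A\<in>UNIV. x $ A *\<^sub>R axis A 1)"
  by (simp add: vec_eq_iff axis_def if_distrib cong: if_cong)

lemma linear_eq_on_axis:
  fixes f g :: "real ^ ('n::finite set) \<Rightarrow> 'b::real_vector"
  assumes "linear f" "linear g" "\<And>A. f (axis A 1) = g (axis A 1)"
  shows "f x = g x"
proof -
  have "f x = (\<Sum>A\<in>UNIV. x $ A *\<^sub>R f (axis A 1))"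
    by (subst clifford_basis_expansion) (simp add: linear_sum[OF assms(1)] linear_scale[OF assms(1)])
  also have "\<dots> = g x"
    unfolding assms(3)
    by (subst (2) clifford_basis_expansion) (simp add: linear_sum[OF assms(2)] linear_scale[OF assms(2)])
  finally show ?thesis .
qed

lemma clifford_mult_assoc: "(x \<odot> y) \<odot> z = x \<odot> (y \<odot> z)"
proof -
  note L = linear_clifford_mult_left and R = linear_clifford_mult_right
  have LR: "linear (\<lambda>z. f (g z))" if "linear f" "linear g"
    for f g :: "'a clifford \<Rightarrow> 'a clifford"
    using linear_compose[OF that(2,1)] by (simp add: o_def)
  have 1: "(axis A 1 \<odot> axis B 1) \<odot> axis C 1 = axis A 1 \<odot> (axis B 1 \<odot> axis C (1::real))"
    for A B C :: "'a set"
  proof -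
    have sd: "sym_diff (sym_diff A B) C = sym_diff A (sym_diff B C)" by blast
    show ?thesis
      by (simp only: clifford_mult_axis linear_scale[OF L] linear_scale[OF R] sd scaleR_scaleR
            clifford_sign_sym_diff_left clifford_sign_sym_diff_right) (simp add: mult_ac)
  qed
  have 2: "(axis A 1 \<odot> axis B 1) \<odot> z = axis A 1 \<odot> (axis B 1 \<odot> z)" for A B and z :: "'a clifford"
    by (rule linear_eq_on_axis[OF R LR[OF R R] 1])
  have 3: "(axis A 1 \<odot> y) \<odot> z = axis A 1 \<odot> (y \<odot> z)" for A and y z :: "'a clifford"
    by (rule linear_eq_on_axis[where x = y,
          OF LR[of "\<lambda>u. u \<odot> z" "\<lambda>y. axis A 1 \<odot> y", OF L R] LR[of "\<lambda>u. axis A 1 \<odot> u" "\<lambda>y. y \<odot> z", OF R L] 2])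
  show ?thesis
    by (rule linear_eq_on_axis[where x = x, OF LR[of "\<lambda>u. u \<odot> z" "\<lambda>x. x \<odot> y", OF L L] L 3])
qed

lemma clifford_one_left: "clifford_one \<odot> x = x"
  by (rule linear_eq_on_axis[where x = x])
     (simp_all add: linear_clifford_mult_right linear_id[unfolded id_def] clifford_one_def
        clifford_mult_axis clifford_sign_def)

lemma clifford_one_right: "x \<odot> clifford_one = x"
  by (rule linear_eq_on_axis[where x = x])
     (simp_all add: linear_clifford_mult_left linear_id[unfolded id_def] clifford_one_def
        clifford_mult_axis clifford_sign_def)

lemma linear_clifford_vec: "linear clifford_vec"
  by (rule linearI) (simp_all add: clifford_vec_def algebra_simps sum.distrib scaleR_sum_right)

lemma clifford_vec_nth: "clifford_vec v $ {i} = v $ i"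
  by (simp add: clifford_vec_def axis_def if_distrib cong: if_cong)

lemma clifford_vec_inject: "clifford_vec v = clifford_vec w \<longleftrightarrow> v = w"
  by (metis clifford_vec_nth vec_eq_iff)

lemma clifford_mult_vec_vec:
  "clifford_vec v \<odot> clifford_vec w =
     (\<Sum>i\<in>UNIV. \<Sum>j\<in>UNIV. (v $ i * w $ j) *\<^sub>R (axis {i} 1 \<odot> axis {j} 1))"
proof -
  have "clifford_vec v \<odot> clifford_vec w = (\<Sum>i\<in>UNIV. v $ i *\<^sub>R (axis {i} 1 \<odot> clifford_vec w))"
    unfolding clifford_vec_def[of v]
    by (simp add: linear_sum[OF linear_clifford_mult_left] linear_scale[OF linear_clifford_mult_left])
  also have "\<dots> = (\<Sum>i\<in>UNIV. v $ i *\<^sub>R (\<Sum>j\<in>UNIV. w $ j *\<^sub>R (axis {i} 1 \<odot> axis {j} 1)))"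
    unfolding clifford_vec_def
    by (simp add: linear_sum[OF linear_clifford_mult_right] linear_scale[OF linear_clifford_mult_right])
  finally show ?thesis by (simp add: scaleR_sum_right)
qed

lemma clifford_relation:
  "clifford_vec v \<odot> clifford_vec w + clifford_vec w \<odot> clifford_vec v = (- 2 * (v \<bullet> w)) *\<^sub>R clifford_one"
proof -
  have ij: "axis {i} 1 \<odot> axis {j} 1 + axis {j} 1 \<odot> axis {i} (1::real) =
      (if i = j then - 2 else 0) *\<^sub>R clifford_one" for i j :: 'a
  proof (cases "i = j")
    case True
    then show ?thesis
      by (simp add: clifford_mult_axis clifford_sign_def clifford_one_def vec_eq_iff)
  next
    case False
    have "sym_diff {i} {j} = sym_diff {j} {i}" by blast
    with False show ?thesis by (auto simp: clifford_mult_axis clifford_sign_def)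
  qed
  have "clifford_vec w \<odot> clifford_vec v =
     (\<Sum>i\<in>UNIV. \<Sum>j\<in>UNIV. (v $ i * w $ j) *\<^sub>R (axis {j} 1 \<odot> axis {i} 1))"
    unfolding clifford_mult_vec_vec by (subst sum.swap) (simp add: mult.commute)
  then have "clifford_vec v \<odot> clifford_vec w + clifford_vec w \<odot> clifford_vec v =
     (\<Sum>i\<in>UNIV. \<Sum>j\<in>UNIV. (v $ i * w $ j) *\<^sub>R (axis {i} 1 \<odot> axis {j} 1 + axis {j} 1 \<odot> axis {i} 1))"
    unfolding clifford_mult_vec_vec[of v w] by (simp add: sum.distrib[symmetric] scaleR_right_distrib)
  also have "\<dots> = (\<Sum>i\<in>UNIV. \<Sum>j\<in>UNIV. if i = j then (v $ i * w $ j * - 2) *\<^sub>R clifford_one else 0)"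
    unfolding ij by (intro sum.cong refl) auto
  also have "\<dots> = (- 2 * (v \<bullet> w)) *\<^sub>R clifford_one"
    by (simp add: inner_vec_def sum_distrib_left scaleR_sum_left mult_ac sum_negf)
  finally show ?thesis .
qed

lemma clifford_vec_square: "clifford_vec v \<odot> clifford_vec v = (- (norm v)\<^sup>2) *\<^sub>R clifford_one"
proof -
  have "2 *\<^sub>R (clifford_vec v \<odot> clifford_vec v) = 2 *\<^sub>R ((- (norm v)\<^sup>2) *\<^sub>R clifford_one)"
    using clifford_relation[of v v] by (simp add: scaleR_2 power2_norm_eq_inner)
  then show ?thesis by (metis scaleR_cancel_left zero_neq_numeral)
qed

lemma clifford_prod_simps [simp]:
  "clifford_prod [] = clifford_one"
  "clifford_prod (v # vs) = clifford_vec v \<odot> clifford_prod vs"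
  "clifford_prod (vs @ ws) = clifford_prod vs \<odot> clifford_prod ws"
proof -
  show "clifford_prod (vs @ ws) = clifford_prod vs \<odot> clifford_prod ws"
    by (induction vs) (simp_all add: clifford_prod_def clifford_one_left clifford_mult_assoc)
qed (simp_all add: clifford_prod_def)

lemma clifford_prod_rev:
  assumes "\<forall>v\<in>set vs. norm v = 1"
  shows "clifford_prod vs \<odot> clifford_prod (rev vs) = (- 1) ^ length vs *\<^sub>R clifford_one"
  using assms
proof (induction vs)
  case (Cons v vs)
  have "clifford_prod (v # vs) \<odot> clifford_prod (rev (v # vs)) =
      clifford_vec v \<odot> (clifford_prod vs \<odot> clifford_prod (rev vs)) \<odot> clifford_vec v"
    by (simp add: clifford_mult_assoc clifford_one_right)
  with Cons show ?case
    by (simp add: linear_scale[OF linear_clifford_mult_left] linear_scale[OF linear_clifford_mult_right]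
        clifford_one_right clifford_vec_square)
qed (simp add: clifford_one_left)

lemma carrier_Spin:
  "carrier Spin = {clifford_prod vs | vs. even (length vs) \<and> (\<forall>v\<in>set vs. norm v = 1)}"
  by (simp add: Spin_def)

lemma Spin_simps [simp]: "mult Spin = (\<odot>)" "one Spin = clifford_one"
  by (simp_all add: Spin_def)

lemma group_Spin: "group Spin"
proof (rule groupI)
  show "\<one>\<^bsub>Spin\<^esub> \<in> carrier Spin"
    unfolding carrier_Spin by (auto intro!: exI[of _ "[]"])
next
  fix x y :: "'a clifford"
  assume "x \<in> carrier Spin" "y \<in> carrier Spin"
  then obtain vs ws where "x = clifford_prod vs" "even (length vs)" "\<forall>v\<in>set vs. norm v = 1"
      "y = clifford_prod ws" "even (length ws)" "\<forall>v\<in>set ws. norm v = 1"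
    unfolding carrier_Spin by auto
  then show "x \<otimes>\<^bsub>Spin\<^esub> y \<in> carrier Spin"
    unfolding carrier_Spin by (auto intro!: exI[of _ "vs @ ws"])
next
  fix x :: "'a clifford"
  assume "x \<in> carrier Spin"
  then obtain vs where vs: "x = clifford_prod vs" "even (length vs)" "\<forall>v\<in>set vs. norm v = 1"
    unfolding carrier_Spin by auto
  then have "clifford_prod (rev vs) \<odot> x = clifford_one"
    using clifford_prod_rev[of "rev vs"] by simp
  moreover have "clifford_prod (rev vs) \<in> carrier Spin"
    unfolding carrier_Spin using vs by (auto intro!: exI[of _ "rev vs"])
  ultimately show "\<exists>y\<in>carrier Spin. y \<otimes>\<^bsub>Spin\<^esub> x = \<one>\<^bsub>Spin\<^esub>" by auto
qed (simp_all add: clifford_mult_assoc clifford_one_left)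

lemma inv_Spin:
  assumes "even (length vs)" "\<forall>v\<in>set vs. norm v = 1"
  shows "inv\<^bsub>Spin\<^esub> (clifford_prod vs) = clifford_prod (rev vs)"
proof (rule group.inv_equality[OF group_Spin])
  show "clifford_prod (rev vs) \<otimes>\<^bsub>Spin\<^esub> clifford_prod vs = \<one>\<^bsub>Spin\<^esub>"
    using clifford_prod_rev[of "rev vs"] assms by simp
  show "clifford_prod vs \<in> carrier Spin" "clifford_prod (rev vs) \<in> carrier Spin"
    unfolding carrier_Spin using assms
    by (blast, force intro!: exI[of _ "rev vs"])
qed

lemma clifford_conj_vec:
  assumes "\<forall>v\<in>set vs. norm v = 1"
  shows "clifford_prod vs \<odot> clifford_vec w \<odot> clifford_prod (rev vs) \<in> range clifford_vec"
  using assms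
proof (induction vs)
  case (Cons v vs)
  then obtain y where y: "clifford_prod vs \<odot> clifford_vec w \<odot> clifford_prod (rev vs) = clifford_vec y"
    by auto
  have "clifford_prod (v # vs) \<odot> clifford_vec w \<odot> clifford_prod (rev (v # vs)) =
      clifford_vec v \<odot> (clifford_prod vs \<odot> clifford_vec w \<odot> clifford_prod (rev vs)) \<odot> clifford_vec v"
    by (simp add: clifford_mult_assoc clifford_one_right)
  also have "\<dots> = clifford_vec v \<odot> clifford_vec y \<odot> clifford_vec v" unfolding y ..
  also have "clifford_vec v \<odot> clifford_vec y =
      (- 2 * (v \<bullet> y)) *\<^sub>R clifford_one - clifford_vec y \<odot> clifford_vec v"
    using clifford_relation[of v y] by (simp add: algebra_simps)
  also have "\<dots> \<odot> clifford_vec v =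
      (- 2 * (v \<bullet> y)) *\<^sub>R clifford_vec v - clifford_vec y \<odot> (clifford_vec v \<odot> clifford_vec v)"
    by (simp only: linear_diff[OF linear_clifford_mult_left] linear_scale[OF linear_clifford_mult_left]
        clifford_one_left clifford_mult_assoc)
  also have "\<dots> = clifford_vec ((- 2 * (v \<bullet> y)) *\<^sub>R v + y)"
    using Cons.prems
    by (simp add: clifford_vec_square linear_scale[OF linear_clifford_mult_right] clifford_one_right
        linear_add[OF linear_clifford_vec] linear_diff[OF linear_clifford_vec]
        linear_scale[OF linear_clifford_vec] linear_neg[OF linear_clifford_vec]
        linear_neg[OF linear_clifford_mult_right])
  finally show ?case by simp
qed (simp add: clifford_one_left clifford_one_right)

lemma spin_Ad:
  assumes "u \<in> carrier Spin"
  shows "clifford_vec (spin_Ad u *v v) = u \<odot> clifford_vec v \<odot> inv\<^bsub>Spin\<^esub> u"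
proof -
  obtain vs where vs: "u = clifford_prod vs" "even (length vs)" "\<forall>v\<in>set vs. norm v = 1"
    using assms unfolding carrier_Spin by auto
  define T where "T v = (THE w. clifford_vec w = u \<odot> clifford_vec v \<odot> inv\<^bsub>Spin\<^esub> u)" for v
  have T: "clifford_vec (T v) = u \<odot> clifford_vec v \<odot> inv\<^bsub>Spin\<^esub> u" for v
  proof -
    have "\<exists>!w. clifford_vec w = u \<odot> clifford_vec v \<odot> inv\<^bsub>Spin\<^esub> u"
      using clifford_conj_vec[of vs v] vs inv_Spin[OF vs(2,3)] by (auto simp: clifford_vec_inject)
    then show ?thesis unfolding T_def by (rule theI')
  qed
  have "linear T"
    by (rule linearI; subst clifford_vec_inject[symmetric])
       (simp_all add: T linear_add[OF linear_clifford_vec] linear_scale[OF linear_clifford_vec]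
         linear_add[OF linear_clifford_mult_left] linear_scale[OF linear_clifford_mult_left]
         linear_add[OF linear_clifford_mult_right] linear_scale[OF linear_clifford_mult_right])
  then have "spin_Ad u *v v = T v"
    by (simp add: spin_Ad_def T_def[abs_def] matrix_works)
  then show ?thesis by (simp add: T)
qed


section \<open>Riemannian flows and transversal Killing spinors on flat space\<close>

text \<open>
  Tensor and spinor fields on \<open>\<Gamma>\R^{n+1}\<close> are given by their lifts to \<^typ>\<open>real ^ 'n\<close>
  (so \<open>CARD('n) = n + 1\<close>): \<open>\<Gamma>\<close>-equivariant maps defined on the whole space.  The lifted metric
  is the Euclidean one, so the Levi-Civita connection and its spinorial lift are the directional
  derivative \<open>flat_conn f x X\<close> of \<open>f\<close> at \<open>x\<close> in the direction \<open>X\<close>.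
\<close>

definition flat_conn :: "('a::real_normed_vector \<Rightarrow> 'b::real_normed_vector) \<Rightarrow> 'a \<Rightarrow> 'a \<Rightarrow> 'b" where
  "flat_conn f x X = frechet_derivative f (at x) X"

fun Ck :: "nat \<Rightarrow> ('a::real_normed_vector \<Rightarrow> 'b::real_normed_vector) \<Rightarrow> bool" where
  "Ck 0 f \<longleftrightarrow> continuous_on UNIV f"
| "Ck (Suc k) f \<longleftrightarrow> (\<forall>x. f differentiable at x) \<and> (\<forall>X. Ck k (\<lambda>x. flat_conn f x X))"

definition smooth :: "('a::real_normed_vector \<Rightarrow> 'b::real_normed_vector) \<Rightarrow> bool" where
  "smooth f \<longleftrightarrow> (\<forall>k. Ck k f)"

text \<open>The Lie derivative of a bilinear form \<open>T\<close>, evaluated on constant vector fields \<open>Z\<close>, \<open>W\<close>;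
  for these \<open>[\<xi>, Z] = - D\<xi>(Z)\<close>.\<close>

definition lie_derivative2 ::
  "('a::real_normed_vector \<Rightarrow> 'a) \<Rightarrow> ('a \<Rightarrow> 'a \<Rightarrow> 'a \<Rightarrow> real) \<Rightarrow> 'a \<Rightarrow> 'a \<Rightarrow> 'a \<Rightarrow> real" where
  "lie_derivative2 \<xi> T x Z W = flat_conn (\<lambda>y. T y Z W) x (\<xi> x)
     + T x (flat_conn \<xi> x Z) W + T x Z (flat_conn \<xi> x W)"

definition riemannian_flow :: "('a::euclidean_space \<Rightarrow> 'a) \<Rightarrow> bool" where
  "riemannian_flow \<xi> \<longleftrightarrow> smooth \<xi> \<and> (\<forall>x. norm (\<xi> x) = 1) \<and>
     (\<forall>x Z W. Z \<bullet> \<xi> x = 0 \<longrightarrow> W \<bullet> \<xi> x = 0 \<longrightarrow> lie_derivative2 \<xi> (\<lambda>_. (\<bullet>)) x Z W = 0)"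

text \<open>The fibre of \<open>Q = \<xi>\<^sup>\<bottom>\<close> at \<open>x\<close>.\<close>

definition normal_fibre :: "('a::euclidean_space \<Rightarrow> 'a) \<Rightarrow> 'a \<Rightarrow> 'a set" where
  "normal_fibre \<xi> x = {Z. Z \<bullet> \<xi> x = 0}"

definition flow_h :: "('a::euclidean_space \<Rightarrow> 'a) \<Rightarrow> 'a \<Rightarrow> 'a \<Rightarrow> 'a" where
  "flow_h \<xi> x Z = flat_conn \<xi> x Z"

definition flow_kappa :: "('a::euclidean_space \<Rightarrow> 'a) \<Rightarrow> 'a \<Rightarrow> 'a" where
  "flow_kappa \<xi> x = flat_conn \<xi> x (\<xi> x)"

definition minimal_flow :: "('a::euclidean_space \<Rightarrow> 'a) \<Rightarrow> bool" where
  "minimal_flow \<xi> \<longleftrightarrow> riemannian_flow \<xi> \<and> (\<forall>x. flow_kappa \<xi> x = 0)"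

text \<open>Composing with the orthogonal projection onto \<open>Q\<close> realizes the extension of \<open>\<Omega>\<close> by
  \<open>\<Omega>(\<xi>, \<sqdot>) = 0\<close>.\<close>

definition normal_proj :: "('a::euclidean_space \<Rightarrow> 'a) \<Rightarrow> 'a \<Rightarrow> 'a \<Rightarrow> 'a" where
  "normal_proj \<xi> x X = X - (X \<bullet> \<xi> x) *\<^sub>R \<xi> x"

definition flow_Omega :: "('a::euclidean_space \<Rightarrow> 'a) \<Rightarrow> 'a \<Rightarrow> 'a \<Rightarrow> 'a \<Rightarrow> real" where
  "flow_Omega \<xi> x X Y = flow_h \<xi> x (normal_proj \<xi> x X) \<bullet> normal_proj \<xi> x Y"

text \<open>Clifford multiplication by vectors and by \<open>2\<close>-forms,
  \<open>\<omega> \<cdot> \<phi> = \<Sum>_{i<j} \<omega>(e_i, e_j) e_i \<cdot> e_j \<cdot> \<phi>\<close>.\<close>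

definition cliff ::
  "('n::{finite,linorder} clifford \<Rightarrow> complex ^ 's ^ 's) \<Rightarrow> (real, 'n) vec \<Rightarrow> complex ^ 's \<Rightarrow> complex ^ 's" where
  "cliff \<rho> v \<phi> = \<rho> (clifford_vec v) *v \<phi>"

definition cliff2 ::
  "('n::{finite,linorder} clifford \<Rightarrow> complex ^ 's ^ 's) \<Rightarrow>
     ((real, 'n) vec \<Rightarrow> (real, 'n) vec \<Rightarrow> real) \<Rightarrow> complex ^ 's \<Rightarrow> complex ^ 's" where
  "cliff2 \<rho> \<omega> \<phi> = (\<Sum>(i, j)\<in>{(i, j). i < j}.
     \<omega> (axis i 1) (axis j 1) *\<^sub>R cliff \<rho> (axis i 1) (cliff \<rho> (axis j 1) \<phi>))"

text \<open>The transversal connection, split into its parts along \<open>\<xi>\<close> and along \<open>Z \<in> Q\<close>.\<close>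

definition trans_conn_xi ::
  "('n::{finite,linorder} clifford \<Rightarrow> complex ^ 's ^ 's) \<Rightarrow> ((real, 'n) vec \<Rightarrow> (real, 'n) vec) \<Rightarrow>
     ((real, 'n) vec \<Rightarrow> complex ^ 's) \<Rightarrow> (real, 'n) vec \<Rightarrow> complex ^ 's" where
  "trans_conn_xi \<rho> \<xi> \<phi> x = flat_conn \<phi> x (\<xi> x) - (1/2) *\<^sub>R cliff2 \<rho> (flow_Omega \<xi> x) (\<phi> x)
     - (1/2) *\<^sub>R cliff \<rho> (\<xi> x) (cliff \<rho> (flow_kappa \<xi> x) (\<phi> x))"

definition trans_conn_Q ::
  "('n::{finite,linorder} clifford \<Rightarrow> complex ^ 's ^ 's) \<Rightarrow> ((real, 'n) vec \<Rightarrow> (real, 'n) vec) \<Rightarrow>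
     ((real, 'n) vec \<Rightarrow> complex ^ 's) \<Rightarrow> (real, 'n) vec \<Rightarrow> (real, 'n) vec \<Rightarrow> complex ^ 's" where
  "trans_conn_Q \<rho> \<xi> \<phi> x Z = flat_conn \<phi> x Z
     - (1/2) *\<^sub>R cliff \<rho> (\<xi> x) (cliff \<rho> (flow_h \<xi> x Z) (\<phi> x))"

text \<open>The second equation is tensorial in \<open>Z\<close>, so it suffices to state it pointwise.\<close>

definition transversal_killing_spinor ::
  "('n::{finite,linorder} clifford \<Rightarrow> complex ^ 's ^ 's) \<Rightarrow> ((real, 'n) vec \<Rightarrow> (real, 'n) vec) \<Rightarrow>
     complex \<Rightarrow> complex \<Rightarrow> ((real, 'n) vec \<Rightarrow> complex ^ 's) \<Rightarrow> bool" where
  "transversal_killing_spinor \<rho> \<xi> \<alpha> \<beta> \<psi> \<longleftrightarrow> smooth \<psi> \<and>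
     (\<forall>x. trans_conn_xi \<rho> \<xi> \<psi> x = \<alpha> *s cliff \<rho> (\<xi> x) (\<psi> x)) \<and>
     (\<forall>x. \<forall>Z\<in>normal_fibre \<xi> x.
        trans_conn_Q \<rho> \<xi> \<psi> x Z = \<beta> *s cliff \<rho> (\<xi> x) (cliff \<rho> Z (\<psi> x)))"

section \<open>Quotients of Euclidean space and their spin structures\<close>

definition isom_plus :: "(real ^ 'n \<Rightarrow> real ^ 'n) monoid" where
  "isom_plus = \<lparr> carrier = {\<gamma>. \<exists>A b. rotation_matrix A \<and> \<gamma> = (\<lambda>x. A *v x + b)},
                 mult = (\<circ>), one = id \<rparr>"

definition transl :: "(real ^ 'n \<Rightarrow> real ^ 'n) \<Rightarrow> real ^ 'n" where
  "transl \<gamma> = \<gamma> 0"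

definition rot :: "(real ^ 'n \<Rightarrow> real ^ 'n) \<Rightarrow> real ^ 'n ^ 'n" where
  "rot \<gamma> = matrix (\<lambda>x. \<gamma> x - \<gamma> 0)"

lemma isom_plus_decomp:
  assumes "\<gamma> \<in> carrier isom_plus"
  shows "rotation_matrix (rot \<gamma>)" "\<gamma> x = rot \<gamma> *v x + transl \<gamma>"
  using assms by (auto simp: isom_plus_def rot_def transl_def)

text \<open>Discreteness refers to the topology of \<open>R^{n+1} \<times> SO_{n+1}\<close>.\<close>

definition free_discrete_group :: "(real ^ 'n \<Rightarrow> real ^ 'n) set \<Rightarrow> bool" where
  "free_discrete_group \<Gamma> \<longleftrightarrow> subgroup \<Gamma> isom_plus \<and> discrete ((\<lambda>\<gamma>. (transl \<gamma>, rot \<gamma>)) ` \<Gamma>) \<and>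
     (\<forall>\<gamma>\<in>\<Gamma>. \<gamma> \<noteq> id \<longrightarrow> (\<forall>x. \<gamma> x \<noteq> x))"

definition spin_structure ::
  "((real, 'n::{finite,linorder}) vec \<Rightarrow> (real, 'n) vec) set \<Rightarrow>
     (((real, 'n) vec \<Rightarrow> (real, 'n) vec) \<Rightarrow> 'n clifford) \<Rightarrow> bool" where
  "spin_structure \<Gamma> \<epsilon> \<longleftrightarrow> \<epsilon> \<in> hom (isom_plus\<lparr>carrier := \<Gamma>\<rparr>) Spin \<and> (\<forall>\<gamma>\<in>\<Gamma>. spin_Ad (\<epsilon> \<gamma>) = rot \<gamma>)"

definition descends_vector_field ::
  "(real ^ 'n \<Rightarrow> real ^ 'n) set \<Rightarrow> (real ^ 'n \<Rightarrow> real ^ 'n) \<Rightarrow> bool" where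
  "descends_vector_field \<Gamma> \<xi> \<longleftrightarrow> (\<forall>\<gamma>\<in>\<Gamma>. \<forall>x. \<xi> (\<gamma> x) = rot \<gamma> *v \<xi> x)"

definition descends_spinor ::
  "('n::{finite,linorder} clifford \<Rightarrow> complex ^ 's ^ 's) \<Rightarrow> ((real, 'n) vec \<Rightarrow> (real, 'n) vec) set \<Rightarrow>
     (((real, 'n) vec \<Rightarrow> (real, 'n) vec) \<Rightarrow> 'n clifford) \<Rightarrow> ((real, 'n) vec \<Rightarrow> complex ^ 's) \<Rightarrow> bool" where
  "descends_spinor \<rho> \<Gamma> \<epsilon> \<psi> \<longleftrightarrow> (\<forall>\<gamma>\<in>\<Gamma>. \<forall>x. \<psi> x = \<rho> (\<epsilon> \<gamma>) *v \<psi> (inv_into UNIV \<gamma> x))"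

end

theory Submission
  imports Defs
begin

text \<open>
  A unit Killing field on Euclidean space is bounded, hence constant, so the transversal connection
  is the flat one and \<open>\<psi>\<close> solves a linear system with constant coefficients whose coefficients
  along unit vectors are multiples of matrices \<open>J\<close> with \<open>J\<^sup>2 = -1\<close>.  The solution along such a
  line is \<open>exp (\<mp> i c t)\<close> on the \<open>\<pm>1\<close>-eigenspaces of \<open>i J\<close>.  Integrability of the system forces
  \<open>\<beta> = 0\<close>, which makes \<open>\<psi>\<close> a function of \<open>x \<bullet> \<xi>\<close> only.  Equivariance splits over the
  eigenspaces because \<open>\<epsilon> \<gamma>\<close> commutes with \<open>\<xi>\<close>.
\<close>

section \<open>Derivatives along lines and rigidity of unit Killing fields\<close>

lemma flat_conn_has_derivative:
  "f differentiable at x \<Longrightarrow> (f has_derivative flat_conn f x) (at x)"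
  unfolding flat_conn_def[abs_def] by (simp add: frechet_derivative_works)

lemma smooth_differentiable: "smooth f \<Longrightarrow> f differentiable at x"
  unfolding smooth_def using Ck.simps(2)[of 0 f] by blast

lemma has_derivative_along_line:
  assumes "\<And>x. (f has_derivative f' x) (at x)"
  shows "((\<lambda>t. f (x + t *\<^sub>R X)) has_vector_derivative f' (x + t *\<^sub>R X) X) (at t)"
proof -
  have "((\<lambda>t. x + t *\<^sub>R X) has_derivative (\<lambda>t. t *\<^sub>R X)) (at t)"
    by (auto intro!: derivative_eq_intros)
  from has_derivative_compose[OF this assms]
  show ?thesis
    using linear_scale[OF has_derivative_linear[OF assms]] by (simp add: has_vector_derivative_def)
qed

text \<open>Integrating along segments, \<open>v\<close> satisfies \<open>(v x - v y) \<bullet> (x - y) = 0\<close>.  Polarizing,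
  \<open>(v y - v 0) \<bullet> x = - (v x - v 0) \<bullet> y\<close>, which is bounded in \<open>x\<close>.\<close>

lemma bounded_killing_field_constant:
  fixes v :: "'a::real_inner \<Rightarrow> 'a"
  assumes deriv: "\<And>x. (v has_derivative v' x) (at x)"
    and skew: "\<And>x X. v' x X \<bullet> X = 0"
    and bounded: "\<And>x. norm (v x) \<le> B"
  shows "v x = v 0"
proof -
  have diff: "(v x - v y) \<bullet> (x - y) = 0" for x y
  proof -
    let ?g = "\<lambda>t. v (y + t *\<^sub>R (x - y)) \<bullet> (x - y)"
    have "(?g has_real_derivative 0) (at t)" for t
    proof -
      have "((\<lambda>t. v (y + t *\<^sub>R (x - y))) has_derivative
          (\<lambda>h. h *\<^sub>R v' (y + t *\<^sub>R (x - y)) (x - y))) (at t)"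
        using has_derivative_along_line[OF deriv] by (simp add: has_vector_derivative_def)
      from has_derivative_inner_left[OF this, of "x - y"]
      show ?thesis by (simp add: skew has_field_derivative_def lambda_zero)
    qed
    then have "?g 1 = ?g 0" by (metis DERIV_isconst_all)
    then show ?thesis by (simp add: inner_diff_left)
  qed
  have polar: "(v y - v 0) \<bullet> x = - ((v x - v 0) \<bullet> y)" for x y
    using diff[of x y] diff[of x 0] diff[of y 0] by (simp add: inner_diff inner_commute)
  have bound: "(v y - v 0) \<bullet> x \<le> 2 * B * norm y" for x y
  proof -
    have "(v y - v 0) \<bullet> x \<le> norm (v x - v 0) * norm y"
      using polar Cauchy_Schwarz_ineq2[of "v x - v 0" y] by (metis abs_le_D2)
    also have "norm (v x - v 0) \<le> 2 * B"
      using bounded[of x] bounded[of 0] norm_triangle_ineq4[of "v x" "v 0"] by linarith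
    finally show ?thesis by (simp add: mult_right_mono)
  qed
  show ?thesis
  proof (rule ccontr)
    define d where "d = v x - v 0"
    assume "v x \<noteq> v 0"
    then have "d \<bullet> d \<noteq> 0" by (simp add: d_def)
    \<comment> \<open>\<open>bound\<close> limits the product of \<open>d\<close> with every vector
      by the same number, so a multiple of \<open>d\<close> is scaled to exceed that number by
      1.\<close>
    then have "d \<bullet> (((2 * B * norm x + 1) / (d \<bullet> d)) *\<^sub>R d) = 2 * B * norm x + 1" by simp
    with bound[of x "((2 * B * norm x + 1) / (d \<bullet> d)) *\<^sub>R d"] show False
      by (simp add: d_def)
  qed
qed

text \<open>A minimal Riemannian flow is Killing: taking W = Z in the Lie derivative condition makes
  the derivative D of \<open>\<xi>\<close> skew on the normal fibre, \<open>flow_kappa\<close> = 0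
  kills D in the direction \<open>\<xi>\<close>, and unit length makes D Z orthogonal to
  \<open>\<xi>\<close>. Unit length also supplies the bound.\<close>

lemma minimal_flow_constant:
  assumes "minimal_flow \<xi>"
  shows "\<xi> x = \<xi> 0"
proof (rule bounded_killing_field_constant)
  have flow: "riemannian_flow \<xi>" and kappa: "\<And>x. flow_kappa \<xi> x = 0"
    using assms by (auto simp: minimal_flow_def)
  have unit: "norm (\<xi> x) = 1" for x using flow by (simp add: riemannian_flow_def)
  show deriv: "(\<xi> has_derivative flat_conn \<xi> x) (at x)" for x
    using flow by (simp add: riemannian_flow_def flat_conn_has_derivative smooth_differentiable)
  show "norm (\<xi> x) \<le> 1" for x using unit by simp
  show "flat_conn \<xi> x X \<bullet> X = 0" for x X
  proof -
    interpret D: linear "flat_conn \<xi> x" using deriv by (rule has_derivative_linear)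
    define Z where "Z = normal_proj \<xi> x X"
    have Z: "Z \<bullet> \<xi> x = 0"
      using unit[of x] by (simp add: Z_def normal_proj_def inner_diff_left dot_square_norm)
    have X: "X = Z + (X \<bullet> \<xi> x) *\<^sub>R \<xi> x" by (simp add: Z_def normal_proj_def)
    have "flat_conn \<xi> x X = flat_conn \<xi> x Z + (X \<bullet> \<xi> x) *\<^sub>R flat_conn \<xi> x (\<xi> x)"
      by (subst X) (simp only: D.add D.scale)
    then have DX: "flat_conn \<xi> x X = flat_conn \<xi> x Z"
      using kappa by (simp add: flow_kappa_def)
    have "((\<lambda>x. \<xi> x \<bullet> \<xi> x) has_derivative (\<lambda>h. \<xi> x \<bullet> flat_conn \<xi> x h + flat_conn \<xi> x h \<bullet> \<xi> x)) (at x)"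
      by (rule has_derivative_inner[OF deriv deriv])
    moreover have "(\<lambda>x. \<xi> x \<bullet> \<xi> x) = (\<lambda>_. 1)" using unit by (simp add: dot_square_norm)
    ultimately have "(\<lambda>h. \<xi> x \<bullet> flat_conn \<xi> x h + flat_conn \<xi> x h \<bullet> \<xi> x) = (\<lambda>_. 0)"
      by (metis has_derivative_const has_derivative_unique)
    then have xi: "flat_conn \<xi> x Z \<bullet> \<xi> x = 0"
      by (metis inner_commute double_zero)
    have "lie_derivative2 \<xi> (\<lambda>_. (\<bullet>)) x Z Z = 0"
      using flow Z by (simp add: riemannian_flow_def)
    then have "flat_conn \<xi> x Z \<bullet> Z = 0"
      by (simp add: lie_derivative2_def flat_conn_def inner_commute)
    with xi show ?thesis
      unfolding DX by (subst X) (simp add: inner_add_right)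
  qed
qed

section \<open>Linear equations with a matrix J of square -1 as coefficient\<close>

lemma exponential_ode:
  fixes g :: "real \<Rightarrow> complex ^ 's"
  assumes "\<And>t. (g has_vector_derivative c *s g t) (at t)"
  shows "g t = exp (c * of_real t) *s g 0"
proof -
  have "g t $ i = exp (c * of_real t) * g 0 $ i" for i
  proof -
    \<comment> \<open>The integrating factor turns each component into a function with zero
      derivative.\<close>
    define k where "k = (\<lambda>t. exp (- c * of_real t) * g t $ i)"
    have g: "((\<lambda>t. g t $ i) has_vector_derivative c * g t $ i) (at t)" for t
      using bounded_linear.has_vector_derivative[OF bounded_linear_vec_nth assms] by simp
    have e: "((\<lambda>t. exp (- c * of_real t)) has_vector_derivative - c * exp (- c * of_real t)) (at t)"
      for t :: real
      by (rule has_vector_derivative_real_field) (auto intro!: derivative_eq_intros)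
    have "(k has_vector_derivative 0) (at t)" for t
      using has_vector_derivative_mult[OF e g] by (simp add: k_def algebra_simps)
    then obtain d where "\<And>t. k t = d"
      using has_vector_derivative_zero_constant[of UNIV k] by auto
    then have "k t = k 0" by simp
    then have "exp (c * of_real t) * (exp (- c * of_real t) * g t $ i) = exp (c * of_real t) * g 0 $ i"
      by (simp add: k_def)
    then show ?thesis by (simp add: mult.assoc[symmetric] mult_exp_exp)
  qed
  then show ?thesis by (simp add: vec_eq_iff)
qed

text \<open>Derivatives are taken over the reals, so complex combinations enter the chain rule as
  real-linear maps. The instances are the eigenprojections \<open>P\<close> (up to a factor 2) and
  the flow \<open>M\<close>.\<close>

lemma bounded_linear_matrix_combination:
  fixes A :: "complex ^ 's ^ 's"
  shows "bounded_linear (\<lambda>u. a *s u + b *s (A *v u))"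
proof -
  have "linear (\<lambda>u. a *s u + b *s (A *v u))"
    by (rule linearI)
       (simp_all add: matrix_vector_right_distrib linear_scale[OF matrix_vector_mul_linear] vec_eq_iff
         algebra_simps)
  then show ?thesis by (simp add: linear_conv_bounded_linear)
qed

text \<open>With \<zeta> = \<i> or -\<i>, the map \<open>P\<close> is twice the projection onto the
  +1 or -1 eigenspace of \<i>J. There J is the scalar -\<zeta>, so \<open>P\<close> turns the matrix
  equation into a scalar one.\<close>

lemma complex_structure_ode:
  fixes f :: "'a::real_normed_vector \<Rightarrow> complex ^ 's"
  assumes deriv: "\<And>x. (f has_derivative f' x) (at x)"
    and X: "\<And>x. f' x X = c *s (J *v f x)"
    and J: "J ** J = - mat 1"
    and \<zeta>: "\<zeta> * \<zeta> = -1"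
  shows "f (x + s *\<^sub>R X) + \<zeta> *s (J *v f (x + s *\<^sub>R X)) =
    exp (- \<zeta> * c * of_real s) *s (f x + \<zeta> *s (J *v f x))"
proof -
  define P where "P = (\<lambda>u. u + \<zeta> *s (J *v u))"
  have JJ: "J *v (J *v u) = - u" for u
    using J matrix_vector_mult_diff_rdistrib[of 0 "mat 1" u] by (simp add: matrix_vector_mul_assoc)
  have blP: "bounded_linear P"
    unfolding P_def using bounded_linear_matrix_combination[of 1 \<zeta> J] by simp
  have P: "P (c *s (J *v u)) = (- \<zeta> * c) *s P u" for u
  proof -
    have "(- \<zeta> * c) * \<zeta> = - (\<zeta> * \<zeta>) * c" by (simp add: mult_ac)
    then have "(- \<zeta> * c) * \<zeta> = c" using \<zeta> by simp
    then show ?thesis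
      by (simp add: P_def vector_scalar_commute JJ add.commute)
  qed
  have "((\<lambda>s. P (f (x + s *\<^sub>R X))) has_vector_derivative (- \<zeta> * c) *s P (f (x + s *\<^sub>R X))) (at s)" for s
    using bounded_linear.has_vector_derivative[OF blP has_derivative_along_line[OF deriv, of x X s]]
    by (simp add: X P)
  from exponential_ode[OF this, of s] show ?thesis by (simp add: P_def)
qed

text \<open>The flow of the first equation is \<open>p + q J\<close> with scalars \<open>p\<close>, \<open>q\<close>, where \<open>q \<noteq> 0\<close> for a suitable
  time, and differentiating it along \<open>Y\<close> shows that \<open>B\<close> commutes with it on \<open>f x\<close>.\<close>

lemma parallel_system_commute:
  fixes f :: "'a::real_normed_vector \<Rightarrow> complex ^ 's"
  assumes deriv: "\<And>x. (f has_derivative f' x) (at x)"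
    and X: "\<And>x. f' x X = c *s (J *v f x)"
    and Y: "\<And>x. f' x Y = B *v f x"
    and J: "J ** J = - mat 1"
    and c: "c \<noteq> 0"
  shows "B *v (J *v f x) = J *v (B *v f x)"
proof -
  \<comment> \<open>The time is chosen to separate the two eigenvalues of the flow. For imaginary
    \<open>c\<close> the exponential at time 1 has modulus different from 1; otherwise
    \<open>s\<close> gives it the phase pi.\<close>
  obtain s :: real where s: "exp (2 * \<i> * c * of_real s) \<noteq> 1"
  proof (cases "Re c = 0")
    case True
    then have "Im c \<noteq> 0" using c by (simp add: complex_eq_iff)
    then have "norm (exp (2 * \<i> * c * of_real 1)) \<noteq> 1" by simp
    then show ?thesis using that by (metis norm_one)
  next
    case False
    define s where "s = pi / (2 * Re c)"
    have "exp (2 * \<i> * c * of_real s) \<noteq> 1"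
    proof
      assume "exp (2 * \<i> * c * of_real s) = 1"
      then obtain n :: int where "Im (2 * \<i> * c * of_real s) = of_int (2 * n) * pi"
        using exp_eq_1 by blast
      then have "pi = of_int (2 * n) * pi" using False by (simp add: s_def)
      then have "of_int (2 * n) = (1 :: real)" by simp
      then have "2 * n = 1" by linarith
      then show False by presburger
    qed
    then show ?thesis by (rule that)
  qed
  define a where "a = exp (- \<i> * c * of_real s)"
  define b where "b = exp (\<i> * c * of_real s)"
  have ab: "a \<noteq> b"
  proof
    assume "a = b"
    then have "b * b = 1" by (metis a_def b_def exp_minus_inverse mult_minus_left)
    moreover have "b * b = exp (2 * \<i> * c * of_real s)"
      using exp_double[of "\<i> * c * of_real s"] by (simp add: b_def power2_eq_square mult.assoc)
    ultimately show False using s by simp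
  qed
  \<comment> \<open>These scalars make p + q J act as \<open>a\<close> where J = -\<i> and as
    \<open>b\<close> where J = \<i>.\<close>
  define p q where "p = (a + b) / 2" and "q = \<i> * (a - b) / 2"
  have flow: "f (y + s *\<^sub>R X) = p *s f y + q *s (J *v f y)" for y
  proof -
    define u where "u = f (y + s *\<^sub>R X)"
    have 1: "u + \<i> *s (J *v u) = a *s (f y + \<i> *s (J *v f y))"
      using complex_structure_ode[OF deriv X J, of \<i> y s] by (simp add: a_def u_def)
    have 2: "u - \<i> *s (J *v u) = b *s (f y - \<i> *s (J *v f y))"
      using complex_structure_ode[OF deriv X J, of "- \<i>" y s] by (simp add: b_def u_def)
    have "u $ j = (p *s f y + q *s (J *v f y)) $ j" for j
    proof -
      have "2 * u $ j = (u + \<i> *s (J *v u)) $ j + (u - \<i> *s (J *v u)) $ j" by simp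
      also have "\<dots> = (a + b) * f y $ j + (\<i> * (a - b)) * (J *v f y) $ j"
        unfolding 1 2 by (simp add: algebra_simps)
      also have "\<dots> = 2 * (p *s f y + q *s (J *v f y)) $ j"
        by (simp add: p_def q_def distrib_left)
      finally show ?thesis by (metis mult_cancel_left zero_neq_numeral)
    qed
    then show ?thesis by (simp add: u_def vec_eq_iff)
  qed
  define M where "M = (\<lambda>u. p *s u + q *s (J *v u))"
  have blM: "bounded_linear M"
    unfolding M_def by (rule bounded_linear_matrix_combination)
  have "((\<lambda>y. f (y + s *\<^sub>R X)) has_derivative (\<lambda>h. f' (x + s *\<^sub>R X) h)) (at x)"
    by (rule has_derivative_compose[OF _ deriv]) (auto intro!: derivative_eq_intros)
  moreover have "((\<lambda>y. M (f y)) has_derivative (\<lambda>h. M (f' x h))) (at x)"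
    by (rule bounded_linear.has_derivative[OF blM deriv])
  moreover have "(\<lambda>y. f (y + s *\<^sub>R X)) = (\<lambda>y. M (f y))" by (simp add: M_def flow)
  ultimately have "f' (x + s *\<^sub>R X) Y = M (f' x Y)"
    by (metis has_derivative_unique)
  then have "B *v f (x + s *\<^sub>R X) = M (B *v f x)" by (simp add: Y)
  \<comment> \<open>Expanding \<open>f (x + s *\<^sub>R X)\<close> by \<open>flow\<close> as well,
    the \<open>p\<close> terms cancel and only the commutator of \<open>B\<close> and
    \<open>J\<close> remains.\<close>
  then have "q *s (B *v (J *v f x)) = q *s (J *v (B *v f x))"
    by (simp add: flow M_def matrix_vector_right_distrib vector_scalar_commute)
  moreover have "q \<noteq> 0" using ab by (simp add: q_def)
  ultimately show ?thesis by (simp add: vec_eq_iff)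
qed

section \<open>Clifford multiplication on spinors and the curvature obstruction\<close>

lemma uminus_matrix_vector: "(- A) *v x = - (A *v (x :: 'a::ring_1 ^ 'n))"
  using matrix_vector_mult_diff_rdistrib[of 0 A x] by simp

lemma unit_orthogonal_exists:
  fixes S :: "'a::euclidean_space set"
  assumes "finite S" "card S < DIM('a)"
  obtains z where "norm z = 1" "\<And>s. s \<in> S \<Longrightarrow> z \<bullet> s = 0"
proof -
  have "dim S < DIM('a)" using dim_le_card'[OF assms(1)] assms(2) by simp
  then obtain y where y: "y \<noteq> 0" "\<And>s. s \<in> span S \<Longrightarrow> orthogonal y s"
    using orthogonal_to_subspace_exists[of S] by metis
  have "norm (y /\<^sub>R norm y) = 1" using y by simp
  moreover have "(y /\<^sub>R norm y) \<bullet> s = 0" if "s \<in> S" for s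
    using y(2)[OF span_base[OF that]] by (simp add: orthogonal_def)
  ultimately show ?thesis by (rule that)
qed

context
  fixes \<rho> :: "'n::{finite,linorder} clifford \<Rightarrow> complex ^ 's ^ 's"
  assumes rep: "spinor_rep \<rho>"
begin

lemma spinor_rep_mult: "\<rho> x *v (\<rho> y *v u) = \<rho> (x \<odot> y) *v u"
  using rep by (simp add: spinor_rep_def matrix_vector_mul_assoc)

lemma cliff_zero: "cliff \<rho> 0 u = 0"
  using rep
  by (simp add: cliff_def spinor_rep_def linear_0[OF linear_clifford_vec] linear_0)

lemma cliff_square:
  assumes "norm v = 1"
  shows "cliff \<rho> v (cliff \<rho> v u) = - u"
  using rep assms
  by (simp add: cliff_def spinor_rep_mult clifford_vec_square)
     (simp add: spinor_rep_def linear_neg uminus_matrix_vector)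

lemma cliff_anticommute:
  assumes "v \<bullet> w = 0"
  shows "cliff \<rho> v (cliff \<rho> w u) = - cliff \<rho> w (cliff \<rho> v u)"
proof -
  have "clifford_vec v \<odot> clifford_vec w = - (clifford_vec w \<odot> clifford_vec v)"
    using clifford_relation[of v w] assms by (simp add: eq_neg_iff_add_eq_0)
  then show ?thesis
    using rep by (simp add: cliff_def spinor_rep_mult spinor_rep_def linear_neg uminus_matrix_vector)
qed

lemma cliff_uminus: "cliff \<rho> v (- u) = - cliff \<rho> v u"
  by (simp add: cliff_def linear_neg[OF matrix_vector_mul_linear])

lemma cliff_matrix_square:
  assumes "norm v = 1"
  shows "\<rho> (clifford_vec v) ** \<rho> (clifford_vec v) = - mat 1"
  using cliff_square[OF assms]
  by (simp add: matrix_eq uminus_matrix_vector cliff_def matrix_vector_mul_assoc)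

text \<open>Swapping the two middle factors costs a sign. This lets e . Z serve as the matrix J in
  the equation along a normal direction Z.\<close>

lemma cliff_orthogonal_matrix_square:
  assumes "norm v = 1" "norm w = 1" "v \<bullet> w = 0"
  shows "(\<rho> (clifford_vec v) ** \<rho> (clifford_vec w)) ** (\<rho> (clifford_vec v) ** \<rho> (clifford_vec w)) = - mat 1"
proof -
  have "cliff \<rho> v (cliff \<rho> w (cliff \<rho> v (cliff \<rho> w u))) = - u" for u
    unfolding cliff_anticommute[OF assms(3), of "cliff \<rho> v (cliff \<rho> w u)"]
    by (simp add: cliff_square cliff_uminus assms)
  then show ?thesis
    by (simp add: matrix_eq uminus_matrix_vector cliff_def flip: matrix_vector_mul_assoc)
qed

lemma cliff_eq_0_iff: "norm v = 1 \<Longrightarrow> cliff \<rho> v u = 0 \<longleftrightarrow> u = 0"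
  using cliff_square[of v u] by (metis cliff_def matrix_vector_mult_0_right neg_equal_0_iff_equal)

text \<open>Flatness of the connection forces \<open>\<beta> = 0\<close>: for orthonormal \<open>Z\<close>, \<open>W\<close> in \<open>e\<^sup>\<bottom>\<close> the
  curvature is \<open>2 \<beta>\<^sup>2 W \<cdot> Z\<close>, and that of \<open>e\<close>, \<open>Z\<close> is \<open>2 \<alpha> \<beta> Z\<close>, which is needed in dimension two.\<close>

lemma killing_constant_eq_0:
  assumes deriv: "\<And>x. (\<psi> has_derivative \<psi>' x) (at x)"
    and e: "norm e = 1"
    and along_e: "\<And>x. \<psi>' x e = \<alpha> *s cliff \<rho> e (\<psi> x)"
    and along_Q: "\<And>x Z. Z \<bullet> e = 0 \<Longrightarrow> \<psi>' x Z = \<beta> *s cliff \<rho> e (cliff \<rho> Z (\<psi> x))"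
    and nonzero: "\<psi> x \<noteq> 0"
    and dim: "CARD('n) \<ge> 2" "CARD('n) = 2 \<Longrightarrow> \<alpha> \<noteq> 0"
  shows "\<beta> = 0"
proof (rule ccontr)
  assume \<beta>: "\<beta> \<noteq> 0"
  obtain Z :: "(real, 'n) vec" where Z: "norm Z = 1" "Z \<bullet> e = 0"
    using unit_orthogonal_exists[of "{e}"] dim by auto
  then have eZ: "e \<bullet> Z = 0" by (simp add: inner_commute)
  let ?c = "\<lambda>v. \<rho> (clifford_vec v)"
  \<comment> \<open>\<open>parallel_system_commute\<close> takes a plain matrix as its second
    coefficient, so the scalar \<beta> is absorbed into the entries.\<close>
  have scaled: "M *v u = \<beta> *s (N *v u)" if "M = (\<chi> i j. \<beta> * N $ i $ j)" for M N :: "complex ^ 's ^ 's" and u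
    by (simp add: that vec_eq_iff matrix_vector_mult_def sum_distrib_left mult_ac)
  show False
  proof (cases "\<alpha> = 0")
    case True
    \<comment> \<open>With \<alpha> = 0 the dimension is at least three, which leaves room for a
      second normal direction \<open>W\<close>.\<close>
    then have "card {e, Z} < DIM((real, 'n) vec)"
      using dim card_insert_le_m1[of 2 "{Z}" e] by (cases "CARD('n) = 2") auto
    then obtain W where W: "norm W = 1" and "\<And>s. s \<in> {e, Z} \<Longrightarrow> W \<bullet> s = 0"
      using unit_orthogonal_exists[of "{e, Z}"] by blast
    then have We: "W \<bullet> e = 0" and "W \<bullet> Z = 0" by simp_all
    then have eW: "e \<bullet> W = 0" and ZW: "Z \<bullet> W = 0" by (simp_all add: inner_commute)
    define B where "B = (\<chi> i j. \<beta> * (?c e ** ?c W) $ i $ j)"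
    have B: "B *v u = \<beta> *s cliff \<rho> e (cliff \<rho> W u)" for u
      using scaled[OF B_def] by (simp add: cliff_def flip: matrix_vector_mul_assoc)
    have "B *v ((?c e ** ?c Z) *v \<psi> x) = (?c e ** ?c Z) *v (B *v \<psi> x)"
    proof (rule parallel_system_commute[OF deriv _ _ _ \<beta>])
      show "\<psi>' y Z = \<beta> *s ((?c e ** ?c Z) *v \<psi> y)" for y
        using along_Q[OF Z(2)] by (simp add: cliff_def flip: matrix_vector_mul_assoc)
      show "\<psi>' y W = B *v \<psi> y" for y using along_Q[OF We] B by simp
      show "?c e ** ?c Z ** (?c e ** ?c Z) = - mat 1"
        by (rule cliff_orthogonal_matrix_square[OF e Z(1) eZ])
    qed
    then have "\<beta> *s cliff \<rho> e (cliff \<rho> W (cliff \<rho> e (cliff \<rho> Z (\<psi> x)))) =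
        \<beta> *s cliff \<rho> e (cliff \<rho> Z (cliff \<rho> e (cliff \<rho> W (\<psi> x))))"
      unfolding B by (simp add: cliff_def vector_scalar_commute flip: matrix_vector_mul_assoc)
    then have "cliff \<rho> W (cliff \<rho> Z (\<psi> x)) = cliff \<rho> Z (cliff \<rho> W (\<psi> x))"
      unfolding cliff_anticommute[OF We] cliff_anticommute[OF Z(2)] cliff_uminus cliff_square[OF e]
      using \<beta> by (simp add: vec_eq_iff)
    \<comment> \<open>Clifford multiplications by \<open>W\<close> and \<open>Z\<close> both commute
      and anticommute on this spinor.\<close>
    then have "cliff \<rho> W (cliff \<rho> Z (\<psi> x)) = 0"
      unfolding cliff_anticommute[OF ZW] by (simp add: vec_eq_iff)
    then show False using nonzero W Z(1) by (simp add: cliff_eq_0_iff)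
  next
    case False
    define B where "B = (\<chi> i j. \<beta> * (?c e ** ?c Z) $ i $ j)"
    have B: "B *v u = \<beta> *s cliff \<rho> e (cliff \<rho> Z u)" for u
      using scaled[OF B_def] by (simp add: cliff_def flip: matrix_vector_mul_assoc)
    \<comment> \<open>Now the flow is along \<open>e\<close> with rate \<alpha>, and
      \<open>Z\<close> is the transverse direction.\<close>
    have "B *v (?c e *v \<psi> x) = ?c e *v (B *v \<psi> x)"
    proof (rule parallel_system_commute[OF deriv _ _ _ False])
      show "\<psi>' y e = \<alpha> *s (?c e *v \<psi> y)" for y
        using along_e by (simp add: cliff_def)
      show "\<psi>' y Z = B *v \<psi> y" for y using along_Q[OF Z(2)] B by simp
      show "?c e ** ?c e = - mat 1" by (rule cliff_matrix_square[OF e])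
    qed
    then have "\<beta> *s cliff \<rho> e (cliff \<rho> Z (cliff \<rho> e (\<psi> x))) =
        \<beta> *s cliff \<rho> e (cliff \<rho> e (cliff \<rho> Z (\<psi> x)))"
      unfolding B by (simp add: cliff_def vector_scalar_commute)
    then have "cliff \<rho> Z (\<psi> x) = 0"
      unfolding cliff_anticommute[OF Z(2)] cliff_uminus cliff_square[OF e]
      using \<beta> by (simp add: vec_eq_iff)
    then show False using nonzero Z by (simp add: cliff_eq_0_iff)
  qed
qed

text \<open>\<open>spin_Ad u\<close> is conjugation by \<open>u\<close>, so \<open>u\<close> commutes with the vectors that it fixes.\<close>

lemma spin_commutes_with_fixed_vector:
  assumes u: "u \<in> carrier Spin" and fixed: "spin_Ad u *v v = v"
  shows "cliff \<rho> v (\<rho> u *v \<phi>) = \<rho> u *v cliff \<rho> v \<phi>"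
proof -
  have "clifford_vec v \<odot> u = u \<odot> clifford_vec v \<odot> (inv\<^bsub>Spin\<^esub> u \<odot> u)"
    using spin_Ad[OF u, of v] fixed by (metis clifford_mult_assoc)
  also have "inv\<^bsub>Spin\<^esub> u \<odot> u = clifford_one"
    using group.l_inv[OF group_Spin u] by simp
  finally show ?thesis by (simp add: cliff_def spinor_rep_mult clifford_one_right)
qed

text \<open>Moving orthogonally to \<open>e\<close> does not change \<psi>, so \<open>x\<close> may
  be replaced by its projection onto the line of \<open>e\<close>, where
  \<open>complex_structure_ode\<close> applies.\<close>

lemma transversally_parallel_spinor:
  assumes deriv: "\<And>x. (\<psi> has_derivative \<psi>' x) (at x)"
    and e: "norm e = 1"
    and along_e: "\<And>x. \<psi>' x e = \<alpha> *s cliff \<rho> e (\<psi> x)"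
    and along_Q: "\<And>x Z. Z \<bullet> e = 0 \<Longrightarrow> \<psi>' x Z = 0"
    and \<zeta>: "\<zeta> * \<zeta> = -1"
  shows "\<psi> x + \<zeta> *s cliff \<rho> e (\<psi> x) =
    exp (- \<zeta> * \<alpha> * of_real (x \<bullet> e)) *s (\<psi> 0 + \<zeta> *s cliff \<rho> e (\<psi> 0))"
proof -
  define Z where "Z = x - (x \<bullet> e) *\<^sub>R e"
  have "Z \<bullet> e = 0" using e by (simp add: Z_def inner_diff_left dot_square_norm)
  \<comment> \<open>Constancy along \<open>Z\<close> is the exponential equation with rate 0; time 1
    reaches \<open>x\<close>.\<close>
  then have "((\<lambda>t. \<psi> ((x \<bullet> e) *\<^sub>R e + t *\<^sub>R Z)) has_vector_derivative
      0 *s \<psi> ((x \<bullet> e) *\<^sub>R e + t *\<^sub>R Z)) (at t)" for t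
    using has_derivative_along_line[OF deriv, of "(x \<bullet> e) *\<^sub>R e" Z t] along_Q by simp
  from exponential_ode[OF this, of 1] have "\<psi> x = \<psi> (0 + (x \<bullet> e) *\<^sub>R e)"
    by (simp add: Z_def)
  then show ?thesis
    using complex_structure_ode[OF deriv along_e[unfolded cliff_def] cliff_matrix_square[OF e] \<zeta>, of 0 "x \<bullet> e"]
    by (simp add: cliff_def)
qed

end

text \<open>Here \<psi> is already the lift to Euclidean space. The assumption \<open>dim\<close>
  excludes genuine exceptions: in the plane with \<alpha> = 0, applying exp(\<beta> (x . Z) e . Z)
  to a constant spinor, for a unit normal Z, gives a solution for every \<beta>, and on the line the
  normal fibre is zero, so \<beta> is unconstrained.\<close>

theorem corollary4p3:
  fixes \<rho> :: "'n::{finite,linorder} clifford \<Rightarrow> complex ^ 's ^ 's"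
    and \<Gamma> :: "((real, 'n) vec \<Rightarrow> (real, 'n) vec) set"
    and \<epsilon> :: "((real, 'n) vec \<Rightarrow> (real, 'n) vec) \<Rightarrow> 'n clifford"
    and \<xi> :: "(real, 'n) vec \<Rightarrow> (real, 'n) vec"
    and \<psi> :: "(real, 'n) vec \<Rightarrow> complex ^ 's"
    and \<alpha> \<beta> :: complex
  assumes dim: "CARD('n) \<ge> 2" "CARD('n) = 2 \<Longrightarrow> \<alpha> \<noteq> 0"
    and \<rho>: "spinor_rep \<rho>"
    and \<Gamma>: "free_discrete_group \<Gamma>"
    and \<epsilon>: "spin_structure \<Gamma> \<epsilon>"
    and \<xi>: "minimal_flow \<xi>" "descends_vector_field \<Gamma> \<xi>"
    and \<psi>: "transversal_killing_spinor \<rho> \<xi> \<alpha> \<beta> \<psi>" "descends_spinor \<rho> \<Gamma> \<epsilon> \<psi>" "\<exists>x. \<psi> x \<noteq> 0"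
  shows "(\<forall>x. \<forall>Z\<in>normal_fibre \<xi> x. flow_h \<xi> x Z = 0) \<and> \<beta> = 0 \<and>
    (\<alpha> = 0 \<longrightarrow> (\<exists>\<psi>\<^sub>0. (\<forall>x. \<psi> x = \<psi>\<^sub>0) \<and> (\<forall>\<gamma>\<in>\<Gamma>. \<psi>\<^sub>0 = \<rho> (\<epsilon> \<gamma>) *v \<psi>\<^sub>0))) \<and>
    (\<alpha> \<noteq> 0 \<longrightarrow> (\<exists>\<psi>p \<psi>m.
       (\<forall>x. \<i> *s cliff \<rho> (\<xi> x) \<psi>p = \<psi>p \<and> \<i> *s cliff \<rho> (\<xi> x) \<psi>m = - \<psi>m) \<and>
       (\<forall>x. \<psi> x = exp (- \<i> * \<alpha> * of_real (x \<bullet> \<xi> x)) *s \<psi>p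
                + exp (\<i> * \<alpha> * of_real (x \<bullet> \<xi> x)) *s \<psi>m) \<and>
       (\<forall>\<gamma>\<in>\<Gamma>. \<forall>x.
          \<psi>p = exp (\<i> * \<alpha> * of_real (transl \<gamma> \<bullet> \<xi> x)) *s (\<rho> (\<epsilon> \<gamma>) *v \<psi>p) \<and>
          \<psi>m = exp (- \<i> * \<alpha> * of_real (transl \<gamma> \<bullet> \<xi> x)) *s (\<rho> (\<epsilon> \<gamma>) *v \<psi>m))))"
proof -
  define e where "e = \<xi> 0"
  have \<xi>_eq: "\<xi> = (\<lambda>_. e)"
    using minimal_flow_constant[OF \<xi>(1)] by (auto simp: e_def)
  have e: "norm e = 1"
    using \<xi>(1) by (simp add: minimal_flow_def riemannian_flow_def \<xi>_eq)
  have dxi: "flat_conn \<xi> x X = 0" for x X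
    by (simp add: \<xi>_eq flat_conn_def)
  have deriv: "(\<psi> has_derivative flat_conn \<psi> x) (at x)" for x
    using \<psi>(1) by (simp add: transversal_killing_spinor_def flat_conn_has_derivative smooth_differentiable)
  have along_e: "flat_conn \<psi> x e = \<alpha> *s cliff \<rho> e (\<psi> x)" for x
  proof -
    have "trans_conn_xi \<rho> \<xi> \<psi> x = \<alpha> *s cliff \<rho> (\<xi> x) (\<psi> x)"
      using \<psi>(1) by (simp add: transversal_killing_spinor_def)
    moreover have "cliff2 \<rho> (flow_Omega \<xi> x) (\<psi> x) = 0"
      by (simp add: cliff2_def flow_Omega_def flow_h_def dxi)
    moreover have "cliff \<rho> (\<xi> x) (cliff \<rho> (flow_kappa \<xi> x) (\<psi> x)) = 0"
      by (simp add: flow_kappa_def dxi cliff_zero[OF \<rho>]) (simp add: cliff_def)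
    ultimately show ?thesis by (simp add: trans_conn_xi_def \<xi>_eq)
  qed
  have along_Q: "flat_conn \<psi> x Z = \<beta> *s cliff \<rho> e (cliff \<rho> Z (\<psi> x))" if "Z \<bullet> e = 0" for x Z
  proof -
    have "trans_conn_Q \<rho> \<xi> \<psi> x Z = \<beta> *s cliff \<rho> (\<xi> x) (cliff \<rho> Z (\<psi> x))"
      using \<psi>(1) that by (simp add: transversal_killing_spinor_def normal_fibre_def \<xi>_eq)
    moreover have "cliff \<rho> (\<xi> x) (cliff \<rho> (flow_h \<xi> x Z) (\<psi> x)) = 0"
      by (simp add: flow_h_def dxi cliff_zero[OF \<rho>]) (simp add: cliff_def)
    ultimately show ?thesis by (simp add: trans_conn_Q_def \<xi>_eq)
  qed
  obtain x\<^sub>0 where "\<psi> x\<^sub>0 \<noteq> 0" using \<psi>(3) by blast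
  then have \<beta>: "\<beta> = 0"
    using killing_constant_eq_0[OF \<rho> deriv e along_e along_Q _ dim] by blast
  then have parallel: "flat_conn \<psi> x Z = 0" if "Z \<bullet> e = 0" for x Z
    using along_Q[OF that, of x] by simp
  have decomp: "\<psi> x + \<zeta> *s cliff \<rho> e (\<psi> x) =
      exp (- \<zeta> * \<alpha> * of_real (x \<bullet> e)) *s (\<psi> 0 + \<zeta> *s cliff \<rho> e (\<psi> 0))"
    if "\<zeta> * \<zeta> = -1" for x \<zeta>
    by (rule transversally_parallel_spinor[OF \<rho> deriv e along_e parallel that])
  \<comment> \<open>The components of \<psi> at the origin in the two eigenspaces of \<i> e.\<close>
  define \<psi>p where "\<psi>p = (1/2) *s (\<psi> 0 + \<i> *s cliff \<rho> e (\<psi> 0))"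
  define \<psi>m where "\<psi>m = (1/2) *s (\<psi> 0 - \<i> *s cliff \<rho> e (\<psi> 0))"
  have plus: "(1/2) *s (\<psi> x + \<i> *s cliff \<rho> e (\<psi> x)) = exp (- \<i> * \<alpha> * of_real (x \<bullet> e)) *s \<psi>p" for x
    unfolding \<psi>p_def decomp[OF i_squared, of x] by (simp only: vector_smult_assoc mult.commute)
  have minus: "(1/2) *s (\<psi> x - \<i> *s cliff \<rho> e (\<psi> x)) = exp (\<i> * \<alpha> * of_real (x \<bullet> e)) *s \<psi>m" for x
  proof -
    have "\<psi> x - \<i> *s cliff \<rho> e (\<psi> x) =
        exp (\<i> * \<alpha> * of_real (x \<bullet> e)) *s (\<psi> 0 - \<i> *s cliff \<rho> e (\<psi> 0))"
      using decomp[of "- \<i>" x] by simp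
    then show ?thesis unfolding \<psi>m_def by (simp only: vector_smult_assoc mult.commute)
  qed
  have \<psi>_eq: "\<psi> x = exp (- \<i> * \<alpha> * of_real (x \<bullet> e)) *s \<psi>p + exp (\<i> * \<alpha> * of_real (x \<bullet> e)) *s \<psi>m" for x
    unfolding plus[symmetric] minus[symmetric] by (simp add: vec_eq_iff algebra_simps)
  have eigen: "\<i> *s cliff \<rho> e \<psi>p = \<psi>p" "\<i> *s cliff \<rho> e \<psi>m = - \<psi>m"
    using cliff_square[OF \<rho> e, of "\<psi> 0"]
    by (simp_all add: \<psi>p_def \<psi>m_def cliff_def matrix_vector_right_distrib matrix_vector_mult_diff_distrib
        vector_scalar_commute vec_eq_iff algebra_simps)
  \<comment> \<open>Equivariance is evaluated at the image of the origin, so that the phase appears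
    on one side only.\<close>
  have \<psi>_transl: "\<psi> (transl \<gamma>) = \<rho> (\<epsilon> \<gamma>) *v \<psi> 0" if "\<gamma> \<in> \<Gamma>" for \<gamma>
  proof -
    have "\<gamma> \<in> carrier isom_plus"
      using \<Gamma> that by (auto simp: free_discrete_group_def dest: subgroup.mem_carrier)
    note \<gamma> = isom_plus_decomp[OF this]
    have "invertible (rot \<gamma>)"
      using \<gamma>(1) by (auto simp: rotation_matrix_def orthogonal_matrix_def invertible_def)
    then have "inj ((*v) (rot \<gamma>))" by (rule inj_matrix_vector_mult)
    then have "inj \<gamma>" unfolding inj_def using \<gamma>(2) by (metis add_right_cancel)
    then have "inv_into UNIV \<gamma> (transl \<gamma>) = 0" by (simp add: transl_def)
    then show ?thesis using \<psi>(2) that by (metis descends_spinor_def)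
  qed
  have equivariant: "\<psi>p = exp (\<i> * \<alpha> * of_real (transl \<gamma> \<bullet> e)) *s (\<rho> (\<epsilon> \<gamma>) *v \<psi>p)"
    "\<psi>m = exp (- \<i> * \<alpha> * of_real (transl \<gamma> \<bullet> e)) *s (\<rho> (\<epsilon> \<gamma>) *v \<psi>m)" if \<gamma>: "\<gamma> \<in> \<Gamma>" for \<gamma>
  proof -
    have "\<epsilon> \<gamma> \<in> carrier Spin"
      using \<epsilon> \<gamma> by (auto simp: spin_structure_def hom_def)
    \<comment> \<open>Invariance of a constant field under \<gamma> means that its rotation part
      fixes \<open>e\<close>.\<close>
    moreover have "spin_Ad (\<epsilon> \<gamma>) *v e = e"
      using \<xi>(2) \<epsilon> \<gamma> by (simp add: descends_vector_field_def spin_structure_def \<xi>_eq)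
    ultimately have comm: "cliff \<rho> e (\<rho> (\<epsilon> \<gamma>) *v \<phi>) = \<rho> (\<epsilon> \<gamma>) *v cliff \<rho> e \<phi>" for \<phi>
      by (rule spin_commutes_with_fixed_vector[OF \<rho>])
    \<comment> \<open>Since \<open>\<epsilon> \<gamma>\<close> commutes with \<open>e\<close>, it
      preserves the eigenspaces, and \<open>\<psi>_transl\<close> can be projected onto each of
      them.\<close>
    have "\<rho> (\<epsilon> \<gamma>) *v \<psi>p = exp (- \<i> * \<alpha> * of_real (transl \<gamma> \<bullet> e)) *s \<psi>p"
      unfolding plus[symmetric] \<psi>_transl[OF \<gamma>] comm
      by (simp add: \<psi>p_def matrix_vector_right_distrib vector_scalar_commute)
    then show "\<psi>p = exp (\<i> * \<alpha> * of_real (transl \<gamma> \<bullet> e)) *s (\<rho> (\<epsilon> \<gamma>) *v \<psi>p)"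
      by (simp add: exp_minus_inverse)
    have "\<rho> (\<epsilon> \<gamma>) *v \<psi>m = exp (\<i> * \<alpha> * of_real (transl \<gamma> \<bullet> e)) *s \<psi>m"
      unfolding minus[symmetric] \<psi>_transl[OF \<gamma>] comm
      by (simp add: \<psi>m_def matrix_vector_mult_diff_distrib vector_scalar_commute)
    then show "\<psi>m = exp (- \<i> * \<alpha> * of_real (transl \<gamma> \<bullet> e)) *s (\<rho> (\<epsilon> \<gamma>) *v \<psi>m)"
      by (simp add: exp_minus)
  qed
  show ?thesis
  proof (intro conjI impI)
    show "\<forall>x. \<forall>Z\<in>normal_fibre \<xi> x. flow_h \<xi> x Z = 0"
      by (simp add: flow_h_def dxi)
    show "\<beta> = 0" by (rule \<beta>)
  next
    assume "\<alpha> = 0"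
    then have const: "\<psi> x = \<psi> 0" for x
      using \<psi>_eq[of x] \<psi>_eq[of 0] by simp
    then have "\<forall>\<gamma>\<in>\<Gamma>. \<psi> 0 = \<rho> (\<epsilon> \<gamma>) *v \<psi> 0" using \<psi>_transl by metis
    with const show "\<exists>\<psi>\<^sub>0. (\<forall>x. \<psi> x = \<psi>\<^sub>0) \<and> (\<forall>\<gamma>\<in>\<Gamma>. \<psi>\<^sub>0 = \<rho> (\<epsilon> \<gamma>) *v \<psi>\<^sub>0)" by blast
  next
    show "\<exists>\<psi>p \<psi>m.
       (\<forall>x. \<i> *s cliff \<rho> (\<xi> x) \<psi>p = \<psi>p \<and> \<i> *s cliff \<rho> (\<xi> x) \<psi>m = - \<psi>m) \<and>
       (\<forall>x. \<psi> x = exp (- \<i> * \<alpha> * of_real (x \<bullet> \<xi> x)) *s \<psi>p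
                + exp (\<i> * \<alpha> * of_real (x \<bullet> \<xi> x)) *s \<psi>m) \<and>
       (\<forall>\<gamma>\<in>\<Gamma>. \<forall>x.
          \<psi>p = exp (\<i> * \<alpha> * of_real (transl \<gamma> \<bullet> \<xi> x)) *s (\<rho> (\<epsilon> \<gamma>) *v \<psi>p) \<and>
          \<psi>m = exp (- \<i> * \<alpha> * of_real (transl \<gamma> \<bullet> \<xi> x)) *s (\<rho> (\<epsilon> \<gamma>) *v \<psi>m))"
      unfolding \<xi>_eq using eigen \<psi>_eq equivariant by blast
  qed
qed

end
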